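(* Let $p$ be a prime, let $d, w_1, w_2 \in \mathbb{N}$, let $\chi$ be a Dirichlet character with conductor $d$ (with values in $\mathbb{C}_p$), and let $\xi \in T_p$. For all $n \in \mathbb{Z}_+$ and $m \in \mathbb{N}$, $$\sum_{j=0}^{n}\binom{n}{j}w_2^{j} w_1^{n-j-1}B_{n-j,\chi,\xi^{w_1}}^{(m)}\sum_{k=0}^{j}\binom{j}{k}T_{k,\chi,\xi^{w_2}}(w_1d-1)\,B_{j-k,\chi,\xi^{w_2}}^{(m-1)}$$ $$=\sum_{j=0}^{n}\binom{n}{j}w_1^{j} w_2^{n-j-1}B_{n-j,\chi,\xi^{w_2}}^{(m)}\sum_{k=0}^{j}\binom{j}{k}T_{k,\chi,\xi^{w_1}}(w_2d-1)\,B_{j-k,\chi,\xi^{w_1}}^{(m-1)}.$$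
   Context: $\mathbb{N}=\{1,2,3,\dots\}$ and $\mathbb{Z}_+=\mathbb{N}\cup\{0\}$. $\mathbb{C}_p$ is the completion of an algebraic closure of $\mathbb{Q}_p$. $T_p=\bigcup_{n\ge 1}\{\omega\in\mathbb{C}_p : \omega^{p^n}=1\}$ is the group of $p$-power roots of unity. For $\xi\in T_p$, a Dirichlet character $\chi$ with conductor $d$, and an integer $k\ge 0$, the generalized twisted Bernoulli polynomials of order $k$ attached to $\chi$, $B_{n,\chi,\xi}^{(k)}(x)$, are defined by the identity of formal power series in $t$ $$\left(\frac{t\sum_{a=0}^{d-1}\chi(a)\xi^a e^{at}}{\xi^d e^{dt}-1}\right)^k e^{xt}=\sum_{n=0}^{\infty}B_{n,\chi,\xi}^{(k)}(x)\frac{t^n}{n!}$$ (so for $k=0$ one has $B_{n,\chi,\xi}^{(0)}(x)=x^n$, with $0^0=1$). The generalized twisted Bernoulli numbers of order $k$ attached to $\chi$ are $B_{n,\chi,\xi}^{(k)}=B_{n,\chi,\xi}^{(k)}(0)$. For $k,n\in\mathbb{Z}_+$, the power sums are $T_{k,\chi,\xi}(n)=\sum_{l=0}^{n}\chi(l)\xi^l l^k$, with $0^0=1$. *)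

theory Defs
  imports
    "HOL-Computational_Algebra.Computational_Algebra"
    "HOL-Number_Theory.Cong"
    "HOL-Analysis.Abstract_Metric_Spaces"
begin

locale nonarch_absolute_value =
  fixes v :: "'a::field_char_0 \<Rightarrow> real"
  assumes v_nonneg: "v x \<ge> 0"
    and v_eq_0_iff: "v x = 0 \<longleftrightarrow> x = 0"
    and v_mult: "v (x * y) = v x * v y"
    and v_add_le_max: "v (x + y) \<le> max (v x) (v y)"
begin

lemma v_1: "v 1 = 1"
  using v_mult[of 1 1] v_eq_0_iff[of 1] by simp

lemma v_minus: "v (- x) = v x"
proof -
  have "v (- 1) * v (- 1) = 1"
    using v_mult[of "- 1" "- 1"] v_1 by simp
  then have "v (- 1) = 1"
    using v_nonneg[of "- 1"] by (metis abs_of_nonneg abs_square_eq_1 power2_eq_square)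
  then show ?thesis
    using v_mult[of "- 1" x] by simp
qed

sublocale Metric_space UNIV "\<lambda>x y. v (x - y)"
proof
  show "v (x - y) \<ge> 0" for x y
    by (rule v_nonneg)
  show "v (x - y) = v (y - x)" for x y
    using v_minus[of "x - y"] by simp
  show "v (x - y) = 0 \<longleftrightarrow> x = y" for x y
    by (simp add: v_eq_0_iff)
  show "v (x - z) \<le> v (x - y) + v (y - z)" for x y z
    using v_add_le_max[of "x - y" "y - z"] v_nonneg[of "x - y"] v_nonneg[of "y - z"] by simp
qed

end

definition algebraic_over :: "'a::field set \<Rightarrow> 'a \<Rightarrow> bool" where
  "algebraic_over F x \<longleftrightarrow> (\<exists>f. f \<noteq> 0 \<and> (\<forall>i. coeff f i \<in> F) \<and> poly f x = 0)"

text \<open>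
  The field \<open>\<complex>\<^sub>p\<close> is determined only up to isometric isomorphism, so it is given as a
  predicate on an arbitrary field \<open>'a\<close> with a function \<open>v\<close>: \<open>v\<close> is a complete absolute value,
  \<open>\<rat>\<^sub>p\<close> is the closure of \<open>\<rat>\<close> in \<open>'a\<close>, the elements algebraic over \<open>\<rat>\<^sub>p\<close>
  form an algebraic closure of \<open>\<rat>\<^sub>p\<close>, and that closure is dense in \<open>'a\<close>.
  Being nonarchimedean with \<open>v p = 1 / p\<close>, \<open>v\<close> restricts to the usual \<open>p\<close>-adic absolute
  value on \<open>\<rat>\<close>, and its restriction to the algebraic closure is the unique extension.
\<close>

locale padic_complex_numbers = nonarch_absolute_value v
  for p :: nat and v :: "'a::field_char_0 \<Rightarrow> real" +
  assumes prime_p: "prime p"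
    and v_p: "v (of_nat p) = 1 / real p"
    and complete: "mcomplete"
    and algebraically_closed:
      "\<And>f :: 'a poly.
         \<lbrakk>degree f > 0; \<forall>i. algebraic_over (mtopology closure_of \<rat>) (coeff f i)\<rbrakk>
         \<Longrightarrow> \<exists>x. algebraic_over (mtopology closure_of \<rat>) x \<and> poly f x = 0"
    and dense:
      "mtopology closure_of {x. algebraic_over (mtopology closure_of \<rat>) x} = UNIV"

definition p_power_roots_of_unity :: "nat \<Rightarrow> 'a::field set" where
  "p_power_roots_of_unity p = (\<Union>n\<in>{1..}. {\<omega>. \<omega> ^ (p ^ n) = 1})"

definition dirichlet_character :: "nat \<Rightarrow> (int \<Rightarrow> 'a::field) \<Rightarrow> bool" where
  "dirichlet_character N chi \<longleftrightarrow> N > 0 \<and>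
     (\<forall>a. chi (a + int N) = chi a) \<and>
     (\<forall>a b. chi (a * b) = chi a * chi b) \<and>
     (\<forall>a. chi a \<noteq> 0 \<longleftrightarrow> coprime a (int N))"

text \<open>The least divisor \<open>c\<close> of \<open>N\<close> such that \<open>chi\<close>, as a character of
  \<open>(\<int>/N)\<^sup>\<times>\<close>, factors through \<open>(\<int>/c)\<^sup>\<times>\<close>.\<close>

definition conductor :: "nat \<Rightarrow> (int \<Rightarrow> 'a::field) \<Rightarrow> nat" where
  "conductor N chi = (LEAST c. c dvd N \<and>
     (\<forall>a. coprime a (int N) \<longrightarrow> [a = 1] (mod int c) \<longrightarrow> chi a = 1))"

text \<open>
  A character with conductor \<open>d\<close> is taken as a function of period \<open>d\<close>, that is,
  as the primitive character modulo \<open>d\<close>. For \<open>d = 1\<close> this is the constant function \<open>1\<close>,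
  also at \<open>0\<close>.
\<close>

definition dirichlet_character_with_conductor :: "nat \<Rightarrow> (int \<Rightarrow> 'a::field) \<Rightarrow> bool" where
  "dirichlet_character_with_conductor d chi \<longleftrightarrow> dirichlet_character d chi \<and> conductor d chi = d"

text \<open>
  If \<open>\<xi>\<^sup>d = 1\<close> the denominator is not a unit, but it has subdegree \<open>1\<close> and the numerator is
  divisible by \<open>t\<close>, so the division is exact in every case
  (see \<open>twisted_bernoulli_gf_mult\<close>).
\<close>

definition twisted_bernoulli_gf ::
    "nat \<Rightarrow> (int \<Rightarrow> 'a::field_char_0) \<Rightarrow> 'a \<Rightarrow> 'a fps" where
  "twisted_bernoulli_gf d chi \<xi> =
     fps_X * (\<Sum>a=0..d-1. fps_const (chi (int a) * \<xi> ^ a) * fps_exp (of_nat a)) /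
     (fps_const (\<xi> ^ d) * fps_exp (of_nat d) - 1)"

definition twisted_bernoulli_poly ::
    "nat \<Rightarrow> (int \<Rightarrow> 'a::field_char_0) \<Rightarrow> 'a \<Rightarrow> nat \<Rightarrow> nat \<Rightarrow> 'a \<Rightarrow> 'a" where
  "twisted_bernoulli_poly d chi \<xi> k n x =
     fact n * fps_nth (twisted_bernoulli_gf d chi \<xi> ^ k * fps_exp x) n"

definition twisted_bernoulli_number ::
    "nat \<Rightarrow> (int \<Rightarrow> 'a::field_char_0) \<Rightarrow> 'a \<Rightarrow> nat \<Rightarrow> nat \<Rightarrow> 'a" where
  "twisted_bernoulli_number d chi \<xi> k n = twisted_bernoulli_poly d chi \<xi> k n 0"

definition twisted_power_sum ::
    "(int \<Rightarrow> 'a::field_char_0) \<Rightarrow> 'a \<Rightarrow> nat \<Rightarrow> nat \<Rightarrow> 'a" where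
  "twisted_power_sum chi \<xi> k n = (\<Sum>l=0..n. chi (int l) * \<xi> ^ l * of_nat l ^ k)"

lemma twisted_bernoulli_gf_mult:
  fixes \<xi> :: "'a::field_char_0"
  assumes "d > 0" "\<xi> \<noteq> 0"
  shows "twisted_bernoulli_gf d chi \<xi> * (fps_const (\<xi> ^ d) * fps_exp (of_nat d) - 1) =
    fps_X * (\<Sum>a=0..d-1. fps_const (chi (int a) * \<xi> ^ a) * fps_exp (of_nat a))"
proof -
  let ?D = "fps_const (\<xi> ^ d) * fps_exp (of_nat d) - 1 :: 'a fps"
  let ?S = "\<Sum>a=0..d-1. fps_const (chi (int a) * \<xi> ^ a) * fps_exp (of_nat a)"
  have nth: "fps_nth ?D 1 \<noteq> 0"
    using assms by simp
  then have D: "?D \<noteq> 0"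
    by (metis fps_zero_nth)
  have "?D dvd fps_X * ?S"
  proof (cases "?S = 0")
    case False
    have "subdegree ?D \<le> 1"
      using nth by (rule subdegree_leI)
    also have "1 \<le> subdegree (fps_X * ?S)"
      using False by (subst subdegree_mult) auto
    finally show ?thesis
      using D False by (simp add: fps_dvd_iff)
  qed simp
  then show ?thesis
    unfolding twisted_bernoulli_gf_def by (rule dvd_div_mult_self)
qed

lemma twisted_bernoulli_poly_gf:
  "twisted_bernoulli_gf d chi \<xi> ^ k * fps_exp x =
   Abs_fps (\<lambda>n. twisted_bernoulli_poly d chi \<xi> k n x / fact n)"
  by (rule fps_ext) (simp add: twisted_bernoulli_poly_def)

lemma twisted_bernoulli_poly_order_0: "twisted_bernoulli_poly d chi \<xi> 0 n x = x ^ n"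
  by (simp add: twisted_bernoulli_poly_def)

end

theory Submission
  imports Defs
begin

text \<open>
  Both sides of the identity are \<open>n!\<close> times the \<open>n\<close>-th coefficient of a power series.
  Write \<open>G\<^sub>w(t)\<close> for the generating function of the twisted Bernoulli numbers of order \<open>1\<close>
  attached to \<open>\<xi>\<^sup>w\<close>, and \<open>S\<^bsub>w, N\<^esub>(t) = \<Sum>l<N. \<chi>(l) \<xi>\<^bsup>wl\<^esup> e\<^bsup>lt\<^esup>\<close> for that of the power sums.
  The left-hand side belongs to
  \<open>G\<^bsub>w1\<^esub>(w1 t)\<^sup>m S\<^bsub>w2, w1 d\<^esub>(w2 t) G\<^bsub>w2\<^esub>(w2 t)\<^bsup>m-1\<^esup> / w1\<close>,
  the right-hand side to the series with \<open>w1\<close> and \<open>w2\<close> exchanged.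

  Since \<open>\<chi>\<close> has period \<open>d\<close>, splitting the power sum into blocks of length \<open>d\<close> gives a
  geometric sum, so that \<open>t S\<^bsub>w2, w1 d\<^esub>(t) = G\<^bsub>w2\<^esub>(t) (\<xi>\<^bsup>w1 w2 d\<^esup> e\<^bsup>w1 d t\<^esup> - 1)\<close>
  (lemma \<open>power_sum_gf_eq_bernoulli_gf\<close>). After the substitution of \<open>w2 t\<close> for \<open>t\<close> the last
  factor is \<open>\<xi>\<^bsup>w1 w2 d\<^esup> e\<^bsup>w1 w2 d t\<^esup> - 1\<close>, which is symmetric in \<open>w1\<close> and \<open>w2\<close>. Hence
  \<open>w1 w2 t\<close> times the first series is
  \<open>G\<^bsub>w1\<^esub>(w1 t)\<^sup>m G\<^bsub>w2\<^esub>(w2 t)\<^sup>m (\<xi>\<^bsup>w1 w2 d\<^esup> e\<^bsup>w1 w2 d t\<^esup> - 1)\<close>, and so is \<open>w1 w2 t\<close> times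
  the second one; this nonzero factor cancels in the domain of formal power series.
\<close>

text \<open>The exponential generating function of the power sums \<open>\<Sum>l<N. \<chi>(l) \<xi>\<^sup>l l\<^sup>k\<close>; the upper
  bound \<open>N\<close> is excluded.\<close>

definition power_sum_gf :: "(int \<Rightarrow> 'a::field_char_0) \<Rightarrow> 'a \<Rightarrow> nat \<Rightarrow> 'a fps" where
  "power_sum_gf chi \<xi> N = (\<Sum>l<N. fps_const (chi (int l) * \<xi> ^ l) * fps_exp (of_nat l))"

text \<open>The substitution \<open>f(t) \<mapsto> f(c t)\<close>.\<close>

definition fps_dilate :: "'a::field_char_0 \<Rightarrow> 'a fps \<Rightarrow> 'a fps" where
  "fps_dilate c f = f oo (fps_const c * fps_X)"

lemma fps_dilate_nth: "fps_nth (fps_dilate c f) n = c ^ n * fps_nth f n"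
  by (simp add: fps_dilate_def fps_compose_linear)

lemma fps_dilate_mult: "fps_dilate c (f * g) = fps_dilate c f * fps_dilate c g"
  by (simp add: fps_dilate_def fps_compose_mult_distrib)

lemma fps_dilate_power: "fps_dilate c (f ^ k) = fps_dilate c f ^ k"
  by (simp add: fps_dilate_def fps_compose_power)

lemma fps_dilate_X: "fps_dilate c fps_X = fps_const c * fps_X"
  by (simp add: fps_dilate_def)

lemma fps_dilate_exp_minus_1:
  "fps_dilate c (fps_const a * fps_exp b - 1) = fps_const a * fps_exp (b * c) - 1"
  by (rule fps_ext) (simp add: fps_dilate_nth power_mult_distrib)

lemma power_sum_gf_nth:
  assumes "N > 0"
  shows "fps_nth (power_sum_gf chi \<xi> N) k = twisted_power_sum chi \<xi> k (N - 1) / fact k"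
proof -
  have "{0..N - 1} = {..<N}"
    using assms by auto
  then show ?thesis
    by (simp add: power_sum_gf_def twisted_power_sum_def fps_sum_nth sum_divide_distrib)
qed

lemma bernoulli_gf_power_nth:
  "fps_nth (twisted_bernoulli_gf d chi \<xi> ^ k) n = twisted_bernoulli_number d chi \<xi> k n / fact n"
  by (simp add: twisted_bernoulli_number_def twisted_bernoulli_poly_def)

lemma periodic_add_mult:
  fixes chi :: "int \<Rightarrow> 'b"
  assumes "\<And>a. chi (a + int d) = chi a"
  shows "chi (a + int (i * d)) = chi a"
proof (induction i)
  case (Suc i)
  have "chi (a + int (Suc i * d)) = chi (a + int (i * d) + int d)"
    by (simp add: algebra_simps)
  then show ?case
    using assms Suc by simp
qed simp

lemma power_sum_gf_blocks:
  fixes chi :: "int \<Rightarrow> 'a::field_char_0"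
  assumes "\<And>a. chi (a + int d) = chi a"
  shows "power_sum_gf chi \<xi> (w * d) =
    power_sum_gf chi \<xi> d * (\<Sum>i<w. (fps_const (\<xi> ^ d) * fps_exp (of_nat d)) ^ i)"
proof -
  let ?f = "\<lambda>l. fps_const (chi (int l) * \<xi> ^ l) * fps_exp (of_nat l) :: 'a fps"
  let ?q = "fps_const (\<xi> ^ d) * fps_exp (of_nat d) :: 'a fps"
  have shift: "?f (l + i * d) = ?f l * ?q ^ i" for l i
  proof -
    have "?q ^ i = fps_const (\<xi> ^ (i * d)) * fps_exp (of_nat (i * d))"
      by (simp add: power_mult_distrib fps_const_power fps_exp_power_mult
          flip: power_mult) (simp add: mult.commute)
    moreover have "fps_exp (of_nat (l + i * d)) =
        (fps_exp (of_nat l) * fps_exp (of_nat (i * d)) :: 'a fps)"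
      by (simp add: fps_exp_add_mult)
    moreover have "fps_const (chi (int (l + i * d)) * \<xi> ^ (l + i * d)) =
        fps_const (chi (int l) * \<xi> ^ l) * fps_const (\<xi> ^ (i * d))"
      using periodic_add_mult[of chi d "int l" i, OF assms]
      by (simp add: power_add mult.assoc)
    ultimately show ?thesis
      by (simp only: mult_ac)
  qed
  have "power_sum_gf chi \<xi> (w * d) = (\<Sum>i<w. sum ?f {i * d..<i * d + d})"
    by (simp only: power_sum_gf_def sum.nat_group)
  also have "\<dots> = (\<Sum>i<w. \<Sum>l<d. ?f (l + i * d))"
    using sum.shift_bounds_nat_ivl[of ?f 0 "i * d" d for i]
    by (simp add: lessThan_atLeast0 add.commute)
  also have "\<dots> = (\<Sum>i<w. power_sum_gf chi \<xi> d * ?q ^ i)"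
    by (simp only: shift power_sum_gf_def sum_distrib_right)
  finally show ?thesis
    by (simp only: sum_distrib_left)
qed

lemma power_sum_gf_eq_bernoulli_gf:
  fixes chi :: "int \<Rightarrow> 'a::field_char_0"
  assumes "\<And>a. chi (a + int d) = chi a" and "d > 0" and "\<xi> \<noteq> 0"
  shows "fps_X * power_sum_gf chi \<xi> (w * d) =
    twisted_bernoulli_gf d chi \<xi> *
      (fps_const (\<xi> ^ (w * d)) * fps_exp (of_nat (w * d)) - 1)"
proof -
  let ?q = "fps_const (\<xi> ^ d) * fps_exp (of_nat d) :: 'a fps"
  let ?G = "twisted_bernoulli_gf d chi \<xi>"
  have "{0..d - 1} = {..<d}"
    using assms by auto
  then have G: "?G * (?q - 1) = fps_X * power_sum_gf chi \<xi> d"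
    using twisted_bernoulli_gf_mult[of d \<xi> chi] assms by (simp add: power_sum_gf_def)
  have "?q ^ w = fps_const (\<xi> ^ (w * d)) * fps_exp (of_nat (w * d))"
    by (simp add: power_mult_distrib fps_const_power fps_exp_power_mult
        flip: power_mult) (simp add: mult.commute)
  moreover have "fps_X * power_sum_gf chi \<xi> (w * d) = ?G * (?q - 1) * (\<Sum>i<w. ?q ^ i)"
    unfolding G power_sum_gf_blocks[of chi d \<xi> w, OF assms(1)] by (simp only: mult.assoc)
  ultimately show ?thesis
    by (simp only: mult.assoc flip: power_diff_1_eq)
qed

text \<open>The exponential generating function of one side of the identity. The factor
  \<open>1 / w1\<close> accounts for the exponent \<open>n - j - 1\<close> of \<open>w1\<close>, which is \<open>-1\<close> for \<open>j = n\<close>.\<close>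

definition side_gf ::
    "nat \<Rightarrow> (int \<Rightarrow> 'a::field_char_0) \<Rightarrow> 'a \<Rightarrow> nat \<Rightarrow> nat \<Rightarrow> nat \<Rightarrow> 'a fps" where
  "side_gf d chi \<xi> m w1 w2 = fps_const (inverse (of_nat w1)) *
     fps_dilate (of_nat w1) (twisted_bernoulli_gf d chi (\<xi> ^ w1) ^ m) *
     fps_dilate (of_nat w2) (power_sum_gf chi (\<xi> ^ w2) (w1 * d) *
       twisted_bernoulli_gf d chi (\<xi> ^ w2) ^ (m - 1))"

lemma fact_mult_nth_side_gf:
  fixes chi :: "int \<Rightarrow> 'a::field_char_0"
  assumes "d > 0" and "w1 > 0"
  shows "fact n * fps_nth (side_gf d chi \<xi> m w1 w2) n =
    (\<Sum>j=0..n. of_nat (n choose j) * of_nat w2 ^ j * of_nat w1 powi (int n - int j - 1) *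
        twisted_bernoulli_number d chi (\<xi> ^ w1) m (n - j) *
        (\<Sum>k=0..j. of_nat (j choose k) * twisted_power_sum chi (\<xi> ^ w2) k (w1 * d - 1) *
          twisted_bernoulli_number d chi (\<xi> ^ w2) (m - 1) (j - k)))"
proof -
  let ?B = "\<lambda>i. twisted_bernoulli_number d chi (\<xi> ^ w1) m i"
  let ?H = "power_sum_gf chi (\<xi> ^ w2) (w1 * d) * twisted_bernoulli_gf d chi (\<xi> ^ w2) ^ (m - 1)"
  let ?I = "\<lambda>j. \<Sum>k=0..j. of_nat (j choose k) * twisted_power_sum chi (\<xi> ^ w2) k (w1 * d - 1) *
          twisted_bernoulli_number d chi (\<xi> ^ w2) (m - 1) (j - k)"
  have inner: "fps_nth ?H j = ?I j / fact j" for j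
  proof -
    have N: "w1 * d > 0"
      using assms by simp
    have "fps_nth ?H j = (\<Sum>k=0..j. twisted_power_sum chi (\<xi> ^ w2) k (w1 * d - 1) / fact k *
        (twisted_bernoulli_number d chi (\<xi> ^ w2) (m - 1) (j - k) / fact (j - k)))"
      by (simp only: fps_mult_nth power_sum_gf_nth[OF N] bernoulli_gf_power_nth)
    also have "\<dots> = ?I j / fact j"
      unfolding sum_divide_distrib by (rule sum.cong[OF refl]) (simp add: binomial_fact)
    finally show ?thesis .
  qed
  have w1_powi: "of_nat w1 powi (int n - int j - 1) =
      inverse (of_nat w1) * (of_nat w1 ^ (n - j) :: 'a)"
    if "j \<le> n" for j
  proof -
    have "of_nat w1 \<noteq> (0 :: 'a)"
      using assms by simp
    then have "of_nat w1 powi (int (n - j) - 1) =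
        of_nat w1 powi int (n - j) / (of_nat w1 powi 1 :: 'a)"
      by (intro power_int_diff) simp
    moreover have "int n - int j - 1 = int (n - j) - 1"
      using that by simp
    ultimately show ?thesis
      by (simp only: power_int_of_nat power_int_1_right divide_inverse mult.commute)
  qed
  have "side_gf d chi \<xi> m w1 w2 = fps_const (inverse (of_nat w1)) *
      (fps_dilate (of_nat w2) ?H *
       fps_dilate (of_nat w1) (twisted_bernoulli_gf d chi (\<xi> ^ w1) ^ m))"
    by (simp only: side_gf_def mult_ac)
  then have "fps_nth (side_gf d chi \<xi> m w1 w2) n = inverse (of_nat w1) *
      (\<Sum>j=0..n. fps_nth (fps_dilate (of_nat w2) ?H) j *
        fps_nth (fps_dilate (of_nat w1) (twisted_bernoulli_gf d chi (\<xi> ^ w1) ^ m)) (n - j))"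
    by (simp only: fps_mult_left_const_nth) (simp only: fps_mult_nth)
  then have "fact n * fps_nth (side_gf d chi \<xi> m w1 w2) n =
    (\<Sum>j=0..n. fact n * (inverse (of_nat w1) * ((of_nat w2 ^ j * (?I j / fact j)) *
      (of_nat w1 ^ (n - j) * (?B (n - j) / fact (n - j))))))"
    by (simp only: fps_dilate_nth inner bernoulli_gf_power_nth sum_distrib_left)
  also have "\<dots> = (\<Sum>j=0..n. of_nat (n choose j) * of_nat w2 ^ j *
      of_nat w1 powi (int n - int j - 1) * ?B (n - j) * ?I j)"
  proof (rule sum.cong[OF refl])
    fix j assume "j \<in> {0..n}"
    then have "j \<le> n" by simp
    show "fact n * (inverse (of_nat w1) * ((of_nat w2 ^ j * (?I j / fact j)) *
        (of_nat w1 ^ (n - j) * (?B (n - j) / fact (n - j))))) =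
      of_nat (n choose j) * of_nat w2 ^ j * of_nat w1 powi (int n - int j - 1) * ?B (n - j) * ?I j"
      unfolding w1_powi[OF \<open>j \<le> n\<close>] binomial_fact[OF \<open>j \<le> n\<close>]
      by (simp only: divide_inverse inverse_mult_distrib mult_ac)
  qed
  finally show ?thesis .
qed

text \<open>The right-hand side is symmetric in \<open>w1\<close> and \<open>w2\<close>. The condition \<open>m > 0\<close> is needed for
  the power sum to complete the \<open>(m - 1)\<close>-st power of the second Bernoulli series to the
  \<open>m\<close>-th.\<close>

lemma side_gf_mult:
  fixes chi :: "int \<Rightarrow> 'a::field_char_0"
  assumes "\<And>a. chi (a + int d) = chi a" and "d > 0" and "\<xi> \<noteq> 0"
    and "w1 > 0" and "w2 > 0" and "m > 0"
  shows "fps_const (of_nat (w1 * w2)) * fps_X * side_gf d chi \<xi> m w1 w2 =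
    fps_dilate (of_nat w1) (twisted_bernoulli_gf d chi (\<xi> ^ w1)) ^ m *
    fps_dilate (of_nat w2) (twisted_bernoulli_gf d chi (\<xi> ^ w2)) ^ m *
    (fps_const (\<xi> ^ (w1 * w2 * d)) * fps_exp (of_nat (w1 * w2 * d)) - 1)"
proof -
  let ?G1 = "fps_dilate (of_nat w1) (twisted_bernoulli_gf d chi (\<xi> ^ w1))"
  let ?G2 = "fps_dilate (of_nat w2) (twisted_bernoulli_gf d chi (\<xi> ^ w2))"
  let ?S = "fps_dilate (of_nat w2) (power_sum_gf chi (\<xi> ^ w2) (w1 * d))"
  let ?E = "fps_const (\<xi> ^ (w1 * w2 * d)) * fps_exp (of_nat (w1 * w2 * d)) - 1 :: 'a fps"
  have "(\<xi> ^ w2) ^ (w1 * d) = \<xi> ^ (w1 * w2 * d)"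
    by (simp add: mult_ac flip: power_mult)
  moreover have "of_nat (w1 * d) * of_nat w2 = (of_nat (w1 * w2 * d) :: 'a)"
    by (simp add: mult_ac)
  ultimately have S: "fps_const (of_nat w2) * fps_X * ?S = ?G2 * ?E"
    using arg_cong[OF power_sum_gf_eq_bernoulli_gf[of chi d "\<xi> ^ w2" w1, OF assms(1,2)],
        of "fps_dilate (of_nat w2)"] assms(3)
    by (simp only: fps_dilate_mult fps_dilate_X fps_dilate_exp_minus_1) simp
  have "fps_const (of_nat (w1 * w2)) * fps_const (inverse (of_nat w1)) =
      (fps_const (of_nat w2) :: 'a fps)"
    using assms by simp
  moreover have "fps_const (of_nat (w1 * w2)) * fps_X * side_gf d chi \<xi> m w1 w2 =
      (fps_const (of_nat (w1 * w2)) * fps_const (inverse (of_nat w1))) * fps_X * ?S *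
        ?G1 ^ m * ?G2 ^ (m - 1)"
    unfolding side_gf_def fps_dilate_mult fps_dilate_power by (simp only: mult_ac)
  ultimately have "fps_const (of_nat (w1 * w2)) * fps_X * side_gf d chi \<xi> m w1 w2 =
      ?G1 ^ m * (?G2 * ?G2 ^ (m - 1)) * ?E"
    by (simp only: S) (simp only: mult_ac)
  also have "?G2 * ?G2 ^ (m - 1) = ?G2 ^ m"
    using assms by (simp add: power_eq_if)
  finally show ?thesis .
qed

lemma side_gf_commute:
  fixes chi :: "int \<Rightarrow> 'a::field_char_0"
  assumes "\<And>a. chi (a + int d) = chi a" and "d > 0" and "\<xi> \<noteq> 0"
    and "w1 > 0" and "w2 > 0" and "m > 0"
  shows "side_gf d chi \<xi> m w1 w2 = side_gf d chi \<xi> m w2 w1"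
proof -
  have "fps_const (of_nat (w1 * w2)) * fps_X * side_gf d chi \<xi> m w1 w2 =
      fps_const (of_nat (w1 * w2)) * fps_X * side_gf d chi \<xi> m w2 w1"
    using side_gf_mult[of chi d \<xi> w1 w2 m, OF assms]
      side_gf_mult[of chi d \<xi> w2 w1 m, OF assms(1-3,5,4,6)]
    by (simp only: mult_ac)
  moreover have "fps_const (of_nat (w1 * w2)) * fps_X \<noteq> (0 :: 'a fps)"
    using assms by simp
  ultimately show ?thesis
    by (metis mult_left_cancel)
qed

theorem corollary2:
  fixes p d w1 w2 n m :: nat
    and v :: "'a::field_char_0 \<Rightarrow> real"
    and chi :: "int \<Rightarrow> 'a"
    and \<xi> :: 'a
  assumes "prime p"
    and "padic_complex_numbers p v"
    and "d \<ge> 1" and "w1 \<ge> 1" and "w2 \<ge> 1"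
    and "dirichlet_character_with_conductor d chi"
    and "\<xi> \<in> p_power_roots_of_unity p"
    and "m \<ge> 1"
  shows
    "(\<Sum>j=0..n. of_nat (n choose j) * of_nat w2 ^ j * of_nat w1 powi (int n - int j - 1) *
        twisted_bernoulli_number d chi (\<xi> ^ w1) m (n - j) *
        (\<Sum>k=0..j. of_nat (j choose k) * twisted_power_sum chi (\<xi> ^ w2) k (w1 * d - 1) *
          twisted_bernoulli_number d chi (\<xi> ^ w2) (m - 1) (j - k))) =
     (\<Sum>j=0..n. of_nat (n choose j) * of_nat w1 ^ j * of_nat w2 powi (int n - int j - 1) *
        twisted_bernoulli_number d chi (\<xi> ^ w2) m (n - j) *
        (\<Sum>k=0..j. of_nat (j choose k) * twisted_power_sum chi (\<xi> ^ w1) k (w2 * d - 1) *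
          twisted_bernoulli_number d chi (\<xi> ^ w1) (m - 1) (j - k)))"
proof -
  have period: "chi (a + int d) = chi a" for a
    using assms(6) by (simp add: dirichlet_character_with_conductor_def dirichlet_character_def)
  obtain r where r: "\<xi> ^ (p ^ r) = 1"
    using assms(7) by (auto simp: p_power_roots_of_unity_def)
  have "p ^ r > 0"
    using prime_gt_0_nat[OF assms(1)] by simp
  then have "\<xi> \<noteq> 0"
    using r by (metis power_0_left less_numeral_extra(3) zero_neq_one)
  then have "side_gf d chi \<xi> m w1 w2 = side_gf d chi \<xi> m w2 w1"
    using side_gf_commute[of chi d \<xi> w1 w2 m, OF period] assms by simp
  then show ?thesis
    using fact_mult_nth_side_gf[of d w1 n chi \<xi> m w2] fact_mult_nth_side_gf[of d w2 n chi \<xi> m w1]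
      assms by simp
qed

end
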